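(* Let $1\leq p\leq 2$, let $\mu_0,\mu_1$ be any two Borel probability measures on $\mathbb{R}$, and let $(\mu_t)_{t\in[0,1]}$ be their monotone interpolation. Then the function $t\mapsto\sqrt{\mathsf{T}_p(\mu_t)}$ is convex on $[0,1]$. In particular, \[ \sqrt{\mathsf{T}_p(\mu_t)}\leq(1-t)\sqrt{\mathsf{T}_p(\mu_0)}+t\sqrt{\mathsf{T}_p(\mu_1)},\qquad t\in(0,1). \]
   Context: For a probability measure $\mu$ on $\mathbb{R}$, its left-continuous quantile function is $Q_\mu(u)=\inf\{x\in\mathbb{R}:\mu((-\infty,x])\geq u\}$, $u\in(0,1)$. Let $\lambda$ be Lebesgue measure on $(0,1)$. The monotone interpolation between $\mu_0$ and $\mu_1$ is $\mu_t=(Q_t)_\#\lambda$ with $Q_t=(1-t)Q_{\mu_0}+tQ_{\mu_1}$, $t\in[0,1]$, where $T_\#\mu$ denotes the image of $\mu$ under $T$. $W_p^p(\mu,\nu)=\inf_{\pi\in\Pi(\mu,\nu)}\int|x-y|^p\,\mathrm{d}\pi(x,y)\in[0,+\infty]$, where $\Pi(\mu,\nu)$ is the set of couplings of $\mu$ and $\nu$. The relative entropy is $\mathrm{H}(\nu\mid\mu)=\int\log\left(\frac{\mathrm{d}\nu}{\mathrm{d}\mu}\right)\mathrm{d}\nu$ if $\nu\ll\mu$, and $+\infty$ otherwise. $\mathsf{T}_p(\mu)\in[0,+\infty]$ denotes the best constant in the inequality $W_p^2(\mu,\nu)\leq C\,\mathrm{H}(\nu\mid\mu)$ for all Borel probability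 measures $\nu$ on $\mathbb{R}$, i.e. the infimum of the constants $C>0$ for which it holds for all $\nu$ ($+\infty$ if there is none). Convexity is understood for $[0,+\infty]$-valued functions. *)

theory Defs
  imports "HOL-Probability.Probability"
begin

(* Real powers on [0,+oo], meant for a > 0 only. *)
definition ennreal_powr :: "ennreal \<Rightarrow> real \<Rightarrow> ennreal" where
  "ennreal_powr x a = (if x = \<top> then \<top> else ennreal (enn2real x powr a))"

definition ennreal_sqrt :: "ennreal \<Rightarrow> ennreal" where
  "ennreal_sqrt x = (if x = \<top> then \<top> else ennreal (sqrt (enn2real x)))"

(* Convexity of [0,+oo]-valued functions; the convention 0 * \<infinity> = 0 of ennreal only
   matters at the trivial weights u = 0 and v = 0. *)
definition ennreal_convex_on :: "real set \<Rightarrow> (real \<Rightarrow> ennreal) \<Rightarrow> bool" where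
  "ennreal_convex_on S f \<longleftrightarrow> convex S \<and>
     (\<forall>x\<in>S. \<forall>y\<in>S. \<forall>u\<ge>0. \<forall>v\<ge>0. u + v = 1 \<longrightarrow>
        f (u * x + v * y) \<le> ennreal u * f x + ennreal v * f y)"

(* Only meaningful for 0 < u < 1, where the set is nonempty and bounded below. *)
definition quantile :: "real measure \<Rightarrow> real \<Rightarrow> real" where
  "quantile \<mu> u = Inf {x. measure \<mu> {..x} \<ge> u}"

definition monotone_interpolation :: "real measure \<Rightarrow> real measure \<Rightarrow> real \<Rightarrow> real measure" where
  "monotone_interpolation \<mu>0 \<mu>1 t =
     distr (restrict_space lborel {0<..<1}) borel
       (\<lambda>u. (1 - t) * quantile \<mu>0 u + t * quantile \<mu>1 u)"

definition couplings :: "real measure \<Rightarrow> real measure \<Rightarrow> (real \<times> real) measure set" where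
  "couplings \<mu> \<nu> = {\<pi>. prob_space \<pi> \<and> sets \<pi> = sets (borel \<Otimes>\<^sub>M borel) \<and>
                      distr \<pi> borel fst = \<mu> \<and> distr \<pi> borel snd = \<nu>}"

definition wasserstein :: "real \<Rightarrow> real measure \<Rightarrow> real measure \<Rightarrow> ennreal" where
  "wasserstein p \<mu> \<nu> =
     ennreal_powr
       (INF \<pi>\<in>couplings \<mu> \<nu>. \<integral>\<^sup>+ z. ennreal (\<bar>fst z - snd z\<bar> powr p) \<partial>\<pi>)
       (1 / p)"

(* H(\<nu> | \<mu>), as the extended (positive minus negative part) integral of the log-density.
   KL_divergence does not serve here: it is a Bochner integral, hence 0 rather than +oo when
   the log-density is not integrable.  For probability measures the negative part is always
   finite, so \<infinity> - \<infinity> does not occur. *)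
definition relative_entropy :: "real measure \<Rightarrow> real measure \<Rightarrow> ereal" where
  "relative_entropy \<nu> \<mu> =
     (if absolutely_continuous \<mu> \<nu>
      then enn2ereal (\<integral>\<^sup>+ x. ennreal (ln (enn2real (RN_deriv \<mu> \<nu> x))) \<partial>\<nu>)
         - enn2ereal (\<integral>\<^sup>+ x. ennreal (- ln (enn2real (RN_deriv \<mu> \<nu> x))) \<partial>\<nu>)
      else \<infinity>)"

(* Borel probability measures on the reals are the library's real_distribution; the infimum
   of the empty set is +oo. *)
definition transport_constant :: "real \<Rightarrow> real measure \<Rightarrow> ennreal" where
  "transport_constant p \<mu> =
     Inf {ennreal C | C. C > 0 \<and>
       (\<forall>\<nu>. real_distribution \<nu> \<longrightarrow>
          enn2ereal ((wasserstein p \<mu> \<nu>)\<^sup>2) \<le> ereal C * relative_entropy \<nu> \<mu>)}"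

end

theory Submission
  imports Defs
begin

text \<open>Let \<open>Q = u P0 + v P1\<close> with \<open>P0\<close>, \<open>P1\<close> nondecreasing on (0,1), and let \<open>\<mu>\<close>, \<open>\<mu>0\<close>, \<open>\<mu>1\<close> be the images of
  Lebesgue measure \<open>\<lambda>\<close> on (0,1) under \<open>Q\<close>, \<open>P0\<close>, \<open>P1\<close>. If \<open>\<nu>\<close> has density \<open>h\<close> with respect to \<open>\<mu>\<close>, pull it
  back to the measure \<open>\<lambda>'\<close> with density \<open>h \<circ> Q\<close> with respect to \<open>\<lambda>\<close>; then \<open>H(\<lambda>' | \<lambda>) = H(\<nu> | \<mu>)\<close>, and the images
  \<open>\<nu>0\<close>, \<open>\<nu>1\<close> of \<open>\<lambda>'\<close> under \<open>P0\<close>, \<open>P1\<close> satisfy \<open>H(\<nu>i | \<mu>i) \<le> H(\<nu> | \<mu>)\<close> by data processing. With \<open>R\<close> the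
  nondecreasing map that sends \<open>\<lambda>\<close> to \<open>\<lambda>'\<close>, the pair \<open>(Q, Q \<circ> R)\<close> couples \<open>\<mu>\<close> and \<open>\<nu>\<close>, whereas \<open>(Pi, Pi \<circ> R)\<close> is
  the monotone, hence optimal, coupling of \<open>\<mu>i\<close> and \<open>\<nu>i\<close>. Minkowski's inequality then gives
  \<open>W(\<mu>, \<nu>) \<le> u W(\<mu>0, \<nu>0) + v W(\<mu>1, \<nu>1) \<le> (u sqrt C0 + v sqrt C1) sqrt (H(\<nu> | \<mu>))\<close>.\<close>

section \<open>Optimality of the monotone coupling\<close>

text \<open>For comonotone \<open>F\<close> and \<open>G\<close> the sets \<open>{F \<le> s}\<close> and \<open>{G \<le> t}\<close> are nested, so the left-hand side
  is the least value \<open>max 0 (P (X \<le> s) - P (Y \<le> t))\<close> allowed by the marginals.\<close>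

lemma prob_comonotone_le:
  fixes F G :: "'a \<Rightarrow> real" and X Y :: "'b \<Rightarrow> real"
  assumes M: "prob_space M" and N: "prob_space N"
    and [measurable]: "F \<in> borel_measurable M" "G \<in> borel_measurable M"
      "X \<in> borel_measurable N" "Y \<in> borel_measurable N"
    and dF: "distr M borel F = distr N borel X" and dG: "distr M borel G = distr N borel Y"
    and comono: "\<And>x y. x \<in> space M \<Longrightarrow> y \<in> space M \<Longrightarrow> F x < F y \<Longrightarrow> G x \<le> G y"
  shows "measure M {x \<in> space M. F x \<le> s \<and> t < G x} \<le> measure N {x \<in> space N. X x \<le> s \<and> t < Y x}"
proof -
  interpret M: prob_space M by fact
  interpret N: prob_space N by fact
  let ?A = "{x \<in> space M. F x \<le> s}" and ?B = "{x \<in> space M. G x \<le> t}"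
  let ?A' = "{x \<in> space N. X x \<le> s}" and ?B' = "{x \<in> space N. Y x \<le> t}"
  let ?C' = "{x \<in> space N. X x \<le> s \<and> t < Y x}"
  have A: "measure M ?A = measure N ?A'"
    using arg_cong[OF dF, of "\<lambda>m. measure m {..s}"]
    by (simp add: measure_distr vimage_def Int_def conj_commute)
  have B: "measure M ?B = measure N ?B'"
    using arg_cong[OF dG, of "\<lambda>m. measure m {..t}"]
    by (simp add: measure_distr vimage_def Int_def conj_commute)
  consider "?A \<subseteq> ?B" | "?B \<subseteq> ?A"
  proof (cases "?A \<subseteq> ?B")
    case False
    then obtain x where x: "x \<in> space M" "F x \<le> s" "\<not> G x \<le> t" by auto
    have "?B \<subseteq> ?A"
    proof clarify
      fix y assume y: "y \<in> space M" "G y \<le> t"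
      show "F y \<le> s" using comono[OF x(1) y(1)] x y by linarith
    qed
    then show ?thesis using that by blast
  qed (use that in blast)
  then show ?thesis
  proof cases
    case 1
    then have "{x \<in> space M. F x \<le> s \<and> t < G x} = {}" by fastforce
    then show ?thesis by (simp only: measure_empty measure_nonneg)
  next
    case 2
    have "{x \<in> space M. F x \<le> s \<and> t < G x} = ?A - ?B" by auto
    then have "measure M {x \<in> space M. F x \<le> s \<and> t < G x} = measure N ?A' - measure N ?B'"
      using 2 A B by (simp add: M.finite_measure_Diff)
    also have "measure N ?A' \<le> measure N (?C' \<union> ?B')"
      by (intro N.finite_measure_mono) auto
    also have "\<dots> \<le> measure N ?C' + measure N ?B'"
      by (intro measure_Un_le) auto
    finally show ?thesis by simp
  qed
qed

text \<open>Note that \<open>ennreal (z - a)\<close> is the positive part of \<open>z - a\<close>.\<close>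

lemma pos_part_powr_mixture:
  fixes p :: real
  assumes "1 \<le> p"
  obtains m :: "real measure" where "sigma_finite_measure m" "sets m = sets borel"
    "\<And>z. ennreal ((max 0 z) powr p) = (\<integral>\<^sup>+a. ennreal (z - a) \<partial>m)"
proof (cases "p = 1")
  case True
  \<comment> \<open>The mixing measure is the second derivative of the \<open>p\<close>-th power of
    the positive part; for \<open>p = 1\<close> this is the unit mass at 0.\<close>
  show ?thesis
  proof (rule that)
    show "sigma_finite_measure (return borel (0::real))"
      by (intro prob_space_imp_sigma_finite prob_space_return) simp
    fix z show "ennreal ((max 0 z) powr p) = (\<integral>\<^sup>+a. ennreal (z - a) \<partial>return borel 0)"
      by (subst nn_integral_return) (auto simp: True max_def ennreal_neg)
  qed simp
next
  case False
  with assms have p: "1 < p" by simp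
  \<comment> \<open>The second derivative of \<open>a powr p\<close> on the positive half-line;
    \<open>key\<close> is then Taylor's formula at 0 with integral remainder.\<close>
  define w where "w a = indicator {0<..} a * (p * (p - 1) * a powr (p - 2))" for a :: real
  have [measurable]: "w \<in> borel_measurable borel" unfolding w_def by measurable
  have key: "ennreal ((max 0 z) powr p) = (\<integral>\<^sup>+a. ennreal (w a) * ennreal (z - a) \<partial>lborel)" for z
  proof (cases "0 < z")
    case False
    then have "ennreal (w a) * ennreal (z - a) = 0" for a
      by (auto simp: w_def indicator_def ennreal_neg)
    then have "(\<integral>\<^sup>+a. ennreal (w a) * ennreal (z - a) \<partial>lborel) = (\<integral>\<^sup>+(a::real). 0 \<partial>lborel)"
      by (simp only:)
    then show ?thesis using False by simp
  next
    case True
    let ?f = "\<lambda>a. p * a powr (p - 1) * z - (p - 1) * a powr p"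
    have "((\<lambda>a. p * (p - 1) * a powr (p - 2) * (z - a)) has_integral (?f z - ?f 0)) {0..z}"
    \<comment> \<open>For \<open>p < 2\<close> the integrand is unbounded near 0, so the
      antiderivative is differentiated in the open interval only and is merely continuous at the
      endpoints.\<close>
    proof (rule fundamental_theorem_of_calculus_interior)
      show "continuous_on {0..z} ?f"
        using p by (intro continuous_on_diff continuous_on_mult continuous_on_powr'
            continuous_on_const continuous_on_id) auto
      fix a assume a: "a \<in> {0<..<z}"
      have "a powr (p - 1) = a powr (p - 2) * a"
        using a powr_add[of a "p - 2" 1] by simp
      then show "(?f has_vector_derivative p * (p - 1) * a powr (p - 2) * (z - a)) (at a)"
        using a unfolding has_real_derivative_iff_has_vector_derivative[symmetric]
        by (auto intro!: derivative_eq_intros simp: algebra_simps)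
    qed (use True in simp)
    moreover have "?f z - ?f 0 = z powr p"
      using True p powr_add[of z "p - 1" 1] by (simp add: algebra_simps)
    ultimately have *: "((\<lambda>a. p * (p - 1) * a powr (p - 2) * (z - a)) has_integral z powr p) {0..z}"
      by simp
    have "ennreal (z powr p) =
       (\<integral>\<^sup>+a. ennreal (indicator {0..z} a * (p * (p - 1) * a powr (p - 2) * (z - a))) \<partial>lborel)"
      by (rule nn_integral_has_integral_lebesgue[OF _ *, symmetric]) (use p in auto)
    also have "\<dots> = (\<integral>\<^sup>+a. ennreal (w a) * ennreal (z - a) \<partial>lborel)"
      using p by (intro nn_integral_cong)
        (auto simp: w_def indicator_def ennreal_mult'[symmetric] ennreal_eq_0_iff mult_nonneg_nonpos)
    finally show ?thesis using True by simp
  qed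
  show ?thesis
  proof (rule that)
    show "sigma_finite_measure (density lborel (\<lambda>a. ennreal (w a)))"
      by (subst sigma_finite_measure.sigma_finite_iff_density_finite[OF sigma_finite_lborel]) auto
    show "ennreal ((max 0 z) powr p) = (\<integral>\<^sup>+a. ennreal (z - a) \<partial>density lborel (\<lambda>a. ennreal (w a)))" for z
      by (subst nn_integral_density) (auto simp: key)
  qed simp
qed

text \<open>A layer-cake formula: the positive part of \<open>G x - F x - a\<close> is the length of
  the interval from \<open>F x\<close> to \<open>G x - a\<close>. Tonelli then leaves the joint
  probabilities that \<open>prob_comonotone_le\<close> compares.\<close>

lemma nn_integral_pos_part_powr:
  fixes F G :: "'a \<Rightarrow> real"
  assumes M: "prob_space M" and m: "sigma_finite_measure m" "sets m = sets borel"
    and mix: "\<And>z. ennreal ((max 0 z) powr p) = (\<integral>\<^sup>+a. ennreal (z - a) \<partial>m)"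
    and [measurable]: "F \<in> borel_measurable M" "G \<in> borel_measurable M"
  shows "(\<integral>\<^sup>+x. ennreal ((max 0 (G x - F x)) powr p) \<partial>M) =
    (\<integral>\<^sup>+a. \<integral>\<^sup>+s. ennreal (measure M {x \<in> space M. F x \<le> s \<and> s + a < G x}) \<partial>lborel \<partial>m)"
proof -
  interpret M: prob_space M by fact
  interpret m: sigma_finite_measure m by fact
  interpret Mm: pair_sigma_finite M m by standard
  interpret Ml: pair_sigma_finite M lborel by standard
  note [measurable_cong] = m(2)
  let ?i = "\<lambda>x a s. indicator {x \<in> space M. F x \<le> s \<and> s + a < G x} x :: ennreal"
  have "(\<integral>\<^sup>+x. ennreal ((max 0 (G x - F x)) powr p) \<partial>M) = (\<integral>\<^sup>+x. \<integral>\<^sup>+a. ennreal (G x - F x - a) \<partial>m \<partial>M)"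
    by (simp add: mix)
  also have "\<dots> = (\<integral>\<^sup>+a. \<integral>\<^sup>+x. ennreal (G x - F x - a) \<partial>M \<partial>m)"
    by (rule Mm.Fubini'[symmetric]) measurable
  also have "\<dots> = (\<integral>\<^sup>+a. \<integral>\<^sup>+x. \<integral>\<^sup>+s. ?i x a s \<partial>lborel \<partial>M \<partial>m)"
  proof (intro nn_integral_cong)
    fix a x assume x: "x \<in> space M"
    have "ennreal (G x - F x - a) = emeasure lborel {F x..<G x - a}"
      by (cases "F x \<le> G x - a") (auto simp: ennreal_neg algebra_simps)
    also have "\<dots> = (\<integral>\<^sup>+s. ?i x a s \<partial>lborel)"
    proof -
      have "?i x a = indicator {F x..<G x - a}"
        using x by (auto simp: indicator_def less_diff_eq)
      then show ?thesis by simp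
    qed
    finally show "ennreal (G x - F x - a) = (\<integral>\<^sup>+s. ?i x a s \<partial>lborel)" .
  qed
  also have "\<dots> = (\<integral>\<^sup>+a. \<integral>\<^sup>+s. \<integral>\<^sup>+x. ?i x a s \<partial>M \<partial>lborel \<partial>m)"
    by (intro nn_integral_cong Ml.Fubini'[symmetric]) measurable
  also have "\<dots> = (\<integral>\<^sup>+a. \<integral>\<^sup>+s. ennreal (measure M {x \<in> space M. F x \<le> s \<and> s + a < G x}) \<partial>lborel \<partial>m)"
    by (simp add: M.emeasure_eq_measure)
  finally show ?thesis .
qed

text \<open>The cost is the sum of the \<open>p\<close>-th powers of the two positive parts. Each
  part is an integral of joint probabilities that a comonotone pair minimizes; comonotonicity is
  symmetric, so the second part follows with the two functions exchanged.\<close>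

lemma comonotone_cost_le:
  fixes F G :: "'a \<Rightarrow> real" and X Y :: "'b \<Rightarrow> real"
  assumes "1 \<le> p" and M: "prob_space M" and N: "prob_space N"
    and [measurable]: "F \<in> borel_measurable M" "G \<in> borel_measurable M"
      "X \<in> borel_measurable N" "Y \<in> borel_measurable N"
    and dF: "distr M borel F = distr N borel X" and dG: "distr M borel G = distr N borel Y"
    and comono: "\<And>x y. x \<in> space M \<Longrightarrow> y \<in> space M \<Longrightarrow> F x < F y \<Longrightarrow> G x \<le> G y"
  shows "(\<integral>\<^sup>+x. ennreal (\<bar>F x - G x\<bar> powr p) \<partial>M) \<le> (\<integral>\<^sup>+x. ennreal (\<bar>X x - Y x\<bar> powr p) \<partial>N)"
proof -
  obtain m where m: "sigma_finite_measure m" "sets m = sets borel"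
    and mix: "\<And>z. ennreal ((max 0 z) powr p) = (\<integral>\<^sup>+a. ennreal (z - a) \<partial>m)"
    using pos_part_powr_mixture[OF \<open>1 \<le> p\<close>] by metis
  have comono': "\<And>x y. x \<in> space M \<Longrightarrow> y \<in> space M \<Longrightarrow> G x < G y \<Longrightarrow> F x \<le> F y"
    using comono by (meson not_le)
  have split: "ennreal (\<bar>x - y\<bar> powr p) = ennreal ((max 0 (y - x)) powr p) + ennreal ((max 0 (x - y)) powr p)"
    for x y :: real by (auto simp: max_def abs_if)
  have "(\<integral>\<^sup>+x. ennreal ((max 0 (G x - F x)) powr p) \<partial>M) \<le> (\<integral>\<^sup>+x. ennreal ((max 0 (Y x - X x)) powr p) \<partial>N)"
    unfolding nn_integral_pos_part_powr[OF M m mix \<open>F \<in> _\<close> \<open>G \<in> _\<close>]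
      nn_integral_pos_part_powr[OF N m mix \<open>X \<in> _\<close> \<open>Y \<in> _\<close>]
    by (intro nn_integral_mono ennreal_leI prob_comonotone_le M N dF dG comono) auto
  moreover have "(\<integral>\<^sup>+x. ennreal ((max 0 (F x - G x)) powr p) \<partial>M) \<le> (\<integral>\<^sup>+x. ennreal ((max 0 (X x - Y x)) powr p) \<partial>N)"
    unfolding nn_integral_pos_part_powr[OF M m mix \<open>G \<in> _\<close> \<open>F \<in> _\<close>]
      nn_integral_pos_part_powr[OF N m mix \<open>Y \<in> _\<close> \<open>X \<in> _\<close>]
    by (intro nn_integral_mono ennreal_leI prob_comonotone_le M N dF dG comono') auto
  ultimately show ?thesis
    by (simp add: split nn_integral_add add_mono)
qed

section \<open>Relative entropy\<close>

text \<open>\<open>RN_deriv\<close> is only determined almost everywhere; by uniqueness, any density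
  may stand in for it in the entropy.\<close>

lemma relative_entropy_density:
  assumes "sigma_finite_measure M" and [measurable]: "f \<in> borel_measurable M"
  shows "relative_entropy (density M f) M =
    enn2ereal (\<integral>\<^sup>+x. f x * ennreal (ln (enn2real (f x))) \<partial>M) -
    enn2ereal (\<integral>\<^sup>+x. f x * ennreal (- ln (enn2real (f x))) \<partial>M)"
proof -
  interpret sigma_finite_measure M by fact
  have ac: "absolutely_continuous M (density M f)"
    by (rule absolutely_continuousI_density) simp
  have AE: "AE x in M. f x = RN_deriv M (density M f) x"
    by (rule RN_deriv_unique) auto
  have "(\<integral>\<^sup>+x. g (RN_deriv M (density M f) x) \<partial>density M f) = (\<integral>\<^sup>+x. f x * g (f x) \<partial>M)"
    if [measurable]: "g \<in> borel_measurable borel" for g :: "ennreal \<Rightarrow> ennreal"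
    by (subst nn_integral_density) (use AE in \<open>auto intro!: nn_integral_cong_AE\<close>)
  from this[of "\<lambda>y. ennreal (ln (enn2real y))"] this[of "\<lambda>y. ennreal (- ln (enn2real y))"]
  show ?thesis using ac by (simp add: relative_entropy_def)
qed

text \<open>The equality case of data processing: the density depends on \<open>x\<close> only
  through \<open>T x\<close>, so a change of variables identifies the two entropies.\<close>

lemma relative_entropy_density_distr:
  assumes M: "prob_space M" and T[measurable]: "T \<in> borel_measurable M"
    and [measurable]: "h \<in> borel_measurable borel"
  shows "relative_entropy (density M (\<lambda>x. h (T x))) M =
    relative_entropy (density (distr M borel T) h) (distr M borel T)"
proof -
  have 1: "sigma_finite_measure M"
    by (rule prob_space_imp_sigma_finite) fact
  have 2: "sigma_finite_measure (distr M borel T)"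
    by (intro prob_space_imp_sigma_finite prob_space.prob_space_distr M T)
  show ?thesis
    by (subst relative_entropy_density[OF 1], simp, subst relative_entropy_density[OF 2], simp,
        simp add: nn_integral_distr)
qed

text \<open>Pointwise, \<open>- y ln y <= 1 - y <= 1\<close> for positive real \<open>y\<close>. At
  \<open>y = \<top>\<close> the product is 0 because \<open>enn2real \<top> = 0\<close> and
  \<open>ln 0 = 0\<close>.\<close>

lemma neg_entropy_integral_le_1:
  assumes M: "prob_space M"
  shows "(\<integral>\<^sup>+x. f x * ennreal (- ln (enn2real (f x))) \<partial>M) \<le> 1"
proof -
  interpret prob_space M by fact
  have "y * ennreal (- ln (enn2real y)) \<le> 1" for y :: ennreal
  proof (cases y)
    case (real r)
    show ?thesis
    proof (cases "r = 0")
      case False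
      with real have r: "0 < r" by simp
      have "- ln r \<le> 1 / r - 1"
        using ln_le_minus_one[of "1 / r"] r by (simp add: ln_div)
      then have "r * (- ln r) \<le> r * (1 / r - 1)"
        using r by (intro mult_left_mono) auto
      also have "\<dots> \<le> 1" using r by (simp add: algebra_simps)
      finally show ?thesis using r real by (simp flip: ennreal_mult')
    qed (simp add: real)
  qed simp
  then have "(\<integral>\<^sup>+x. f x * ennreal (- ln (enn2real (f x))) \<partial>M) \<le> (\<integral>\<^sup>+x. 1 \<partial>M)"
    by (intro nn_integral_mono) auto
  then show ?thesis by (simp add: emeasure_space_1)
qed

text \<open>The data processing inequality, from \<open>f ln k - f ln f \<le> k - f\<close> with \<open>k\<close> the pulled-back
  density, written with positive and negative parts to integrate without integrability
  conditions.\<close>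

lemma relative_entropy_distr_le:
  assumes M: "prob_space M" and f[measurable]: "f \<in> borel_measurable M"
    and Mf: "prob_space (density M f)" and T[measurable]: "T \<in> borel_measurable M"
  shows "relative_entropy (distr (density M f) borel T) (distr M borel T) \<le>
    relative_entropy (density M f) M"
proof -
  interpret M: prob_space M by fact
  interpret Mf: prob_space "density M f" by fact
  define N where "N = distr M borel T"
  define N' where "N' = distr (density M f) borel T"
  have T'[measurable]: "T \<in> borel_measurable (density M f)" by simp
  interpret N: prob_space N unfolding N_def by (rule M.prob_space_distr) simp
  interpret N': prob_space N' unfolding N'_def by (rule Mf.prob_space_distr) simp
  have [measurable_cong, simp]: "sets N = sets borel" "sets N' = sets borel"
    by (auto simp: N_def N'_def)
  have ac: "absolutely_continuous N N'"
    unfolding absolutely_continuous_def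
  proof
    fix A assume "A \<in> null_sets N"
    then have A[measurable]: "A \<in> sets borel" and "emeasure M (T -` A \<inter> space M) = 0"
      by (auto simp: null_sets_def N_def emeasure_distr)
    then have "T -` A \<inter> space M \<in> null_sets M" by auto
    then have "T -` A \<inter> space M \<in> null_sets (density M f)"
      using absolutely_continuousI_density[OF f] by (auto simp: absolutely_continuous_def)
    then show "A \<in> null_sets N'"
      using A by (auto simp: null_sets_def N'_def emeasure_distr)
  qed
  define g where "g = RN_deriv N N'"
  have g[measurable]: "g \<in> borel_measurable borel"
    unfolding g_def using borel_measurable_RN_deriv[of N N'] by simp
  have dg: "density N g = N'"
    unfolding g_def by (rule N.density_RN_deriv) (use ac in auto)
  have g_N: "g \<in> borel_measurable N" by simp
  have int_N: "(\<integral>\<^sup>+y. g y * \<phi> y \<partial>N) = (\<integral>\<^sup>+x. f x * \<phi> (T x) \<partial>M)"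
    if [measurable]: "\<phi> \<in> borel_measurable borel" for \<phi>
  proof -
    have "(\<integral>\<^sup>+y. g y * \<phi> y \<partial>N) = (\<integral>\<^sup>+y. \<phi> y \<partial>N')"
      unfolding dg[symmetric] by (subst nn_integral_density) auto
    also have "\<dots> = (\<integral>\<^sup>+x. f x * \<phi> (T x) \<partial>M)"
      unfolding N'_def by (subst nn_integral_distr) (auto simp: nn_integral_density)
    finally show ?thesis .
  qed
  have f1: "(\<integral>\<^sup>+x. f x \<partial>M) = 1"
    using Mf.emeasure_space_1 by (simp add: emeasure_density cong: nn_integral_cong)
  have k1: "(\<integral>\<^sup>+x. g (T x) \<partial>M) = 1"
  proof -
    have "(\<integral>\<^sup>+x. g (T x) \<partial>M) = (\<integral>\<^sup>+y. g y * 1 \<partial>N)"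
      unfolding N_def by (subst nn_integral_distr) auto
    then show ?thesis by (subst (asm) int_N) (auto simp: f1)
  qed
  have "(\<integral>\<^sup>+x. f x * (if g (T x) = 0 then 1 else 0) \<partial>M) = (\<integral>\<^sup>+y. g y * (if g y = 0 then 1 else 0) \<partial>N)"
    by (subst int_N) auto
  also have "\<dots> = 0" by (simp add: if_distrib cong: if_cong)
  \<comment> \<open>The set where \<open>g\<close> vanishes has no mass under \<open>N'\<close>.
    Hence the convention \<open>ln 0 = 0\<close> never replaces minus infinity where
    \<open>f\<close> is positive, up to a null set.\<close>
  finally have pos: "AE x in M. g (T x) = 0 \<longrightarrow> f x = 0"
    by (subst (asm) nn_integral_0_iff_AE) (auto split: if_splits)
  have "AE x in M. f x \<noteq> \<infinity>" "AE x in M. g (T x) \<noteq> \<infinity>"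
    by (rule nn_integral_PInf_AE; simp add: f1 k1)+
  with pos have pointwise: "AE x in M.
    f x * ennreal (ln (enn2real (g (T x)))) + f x + f x * ennreal (- ln (enn2real (f x))) \<le>
    f x * ennreal (ln (enn2real (f x))) + g (T x) + f x * ennreal (- ln (enn2real (g (T x))))"
  proof eventually_elim
    case (elim x)
    obtain r q where r: "f x = ennreal r" "0 \<le> r" and q: "g (T x) = ennreal q" "0 \<le> q"
      using elim(2,3) by (cases "f x"; cases "g (T x)") auto
    show ?case
    proof (cases "r = 0")
      case False
      with r q elim(1) have rq: "0 < r" "0 < q" by auto
      have "ln q - ln r \<le> q / r - 1"
        using ln_le_minus_one[of "q / r"] rq by (simp add: ln_div)
      then have "r * (ln q - ln r) \<le> r * (q / r - 1)"
        using rq by (intro mult_left_mono) auto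
      then have "r * max 0 (ln q) + r + r * max 0 (- ln r) \<le> r * max 0 (ln r) + q + r * max 0 (- ln q)"
        using rq by (auto simp: max_def algebra_simps)
      moreover have "ennreal r * ennreal y = ennreal (r * max 0 y)" for y
        using rq by (cases "0 \<le> y") (auto simp: ennreal_mult' ennreal_neg max_def)
      ultimately show ?thesis
        using rq by (simp add: r q flip: ennreal_plus)
    qed (simp add: r)
  qed
  define Ap An Bp Bn where "Ap = (\<integral>\<^sup>+x. f x * ennreal (ln (enn2real (g (T x)))) \<partial>M)"
    and "An = (\<integral>\<^sup>+x. f x * ennreal (- ln (enn2real (g (T x)))) \<partial>M)"
    and "Bp = (\<integral>\<^sup>+x. f x * ennreal (ln (enn2real (f x))) \<partial>M)"
    and "Bn = (\<integral>\<^sup>+x. f x * ennreal (- ln (enn2real (f x))) \<partial>M)"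
  have ineq: "Ap + 1 + Bn \<le> Bp + 1 + An"
    using nn_integral_mono_AE[OF pointwise]
    by (simp add: nn_integral_add f1 k1 Ap_def An_def Bp_def Bn_def)
  \<comment> \<open>Finite negative parts may be subtracted on both sides of
    \<open>ineq\<close>.\<close>
  have "Bn \<le> 1" unfolding Bn_def by (rule neg_entropy_integral_le_1[OF M])
  moreover have "An \<le> 1"
    using neg_entropy_integral_le_1[OF N.prob_space_axioms, of g] by (simp add: int_N An_def)
  ultimately obtain a b where ab: "An = ennreal a" "0 \<le> a" "Bn = ennreal b" "0 \<le> b"
    by (cases An; cases Bn) (auto simp: top_unique)
  have "enn2ereal Ap - enn2ereal An \<le> enn2ereal Bp - enn2ereal Bn"
  proof (cases Bp)
    case (real B)
    with ineq ab obtain A where A: "Ap = ennreal A" "0 \<le> A"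
      by (cases Ap) (auto simp: top_unique simp flip: ennreal_plus ennreal_1)
    show ?thesis
      using ineq real A ab by (simp flip: ennreal_plus ennreal_1)
  qed (simp add: ab)
  moreover have "relative_entropy N' N = enn2ereal Ap - enn2ereal An"
    unfolding dg[symmetric] relative_entropy_density[OF N.sigma_finite_measure_axioms g_N]
    by (simp add: int_N Ap_def An_def)
  moreover have "relative_entropy (density M f) M = enn2ereal Bp - enn2ereal Bn"
    by (simp add: relative_entropy_density[OF M.sigma_finite_measure_axioms f] Bp_def Bn_def)
  ultimately show ?thesis by (simp add: N_def N'_def)
qed

section \<open>Minkowski's inequality\<close>

text \<open>Convexity of the power is used for positive arguments; when \<open>s\<close> or
  \<open>t\<close> is 0, the inequality reduces to \<open>c powr p <= c\<close> for \<open>c\<close>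
  in [0,1].\<close>

lemma powr_convex_ineq:
  fixes s t \<theta> p :: real
  assumes p: "1 \<le> p" and "0 \<le> s" "0 \<le> t" "0 \<le> \<theta>" "\<theta> \<le> 1"
  shows "(\<theta> * s + (1 - \<theta>) * t) powr p \<le> \<theta> * s powr p + (1 - \<theta>) * t powr p"
proof -
  have scale: "(c * x) powr p \<le> c * x powr p" if "0 \<le> c" "c \<le> 1" "0 \<le> x" for c x :: real
  proof -
    have "c powr p \<le> c" using powr_mono'[of 1 p c] p that by simp
    then show ?thesis using that by (simp add: powr_mult mult_right_mono)
  qed
  consider "s = 0" | "t = 0" | "0 < s" "0 < t" using assms by linarith
  then show ?thesis
  proof cases
    case 3
    then show ?thesis
      using convex_onD[OF powr_convex[OF p], of "1 - \<theta>" s t] assms by (simp add: algebra_simps)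
  qed (use scale[of \<theta> s] scale[of "1 - \<theta>" t] assms in auto)
qed

text \<open>After division by \<open>D = u A + v B\<close>, the sum is a convex combination of
  \<open>a / A\<close> and \<open>b / B\<close> with weights \<open>u A / D\<close> and
  \<open>v B / D\<close>. Convexity of the power, integrated, gives the bound. Positive upper bounds
  \<open>A\<close>, \<open>B\<close> in place of the norms keep the divisions legitimate.\<close>

lemma nn_integral_powr_add_le:
  fixes a b :: "'a \<Rightarrow> real"
  assumes p: "1 \<le> p" and AB: "0 < A" "0 < B" and uv: "0 \<le> u" "0 \<le> v"
    and [measurable]: "a \<in> borel_measurable M" "b \<in> borel_measurable M"
    and a: "(\<integral>\<^sup>+x. ennreal (\<bar>a x\<bar> powr p) \<partial>M) \<le> ennreal (A powr p)"
    and b: "(\<integral>\<^sup>+x. ennreal (\<bar>b x\<bar> powr p) \<partial>M) \<le> ennreal (B powr p)"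
  shows "(\<integral>\<^sup>+x. ennreal (\<bar>u * a x + v * b x\<bar> powr p) \<partial>M) \<le> ennreal ((u * A + v * B) powr p)"
proof (cases "u = 0 \<and> v = 0")
  case False
  define D where "D = u * A + v * B"
  have D: "0 < D" using False AB uv unfolding D_def
    by (cases "u = 0"; simp add: add_pos_nonneg)
  define \<theta> where "\<theta> = u * A / D"
  have \<theta>: "0 \<le> \<theta>" "\<theta> \<le> 1" "1 - \<theta> = v * B / D"
    using D AB uv by (auto simp: \<theta>_def D_def field_simps)
  define \<alpha> where "\<alpha> = D powr p * \<theta> / A powr p"
  define \<beta> where "\<beta> = D powr p * (1 - \<theta>) / B powr p"
  have nonneg: "0 \<le> \<alpha>" "0 \<le> \<beta>" using \<theta>(1,2) by (auto simp: \<alpha>_def \<beta>_def)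
  have pw: "\<bar>u * a x + v * b x\<bar> powr p \<le> \<alpha> * \<bar>a x\<bar> powr p + \<beta> * \<bar>b x\<bar> powr p" for x
  proof -
    have "\<bar>u * a x + v * b x\<bar> \<le> u * \<bar>a x\<bar> + v * \<bar>b x\<bar>"
      using uv abs_triangle_ineq[of "u * a x" "v * b x"] by (simp add: abs_mult)
    also have "\<dots> = D * (\<theta> * (\<bar>a x\<bar> / A) + (1 - \<theta>) * (\<bar>b x\<bar> / B))"
      unfolding \<theta>(3) using D AB by (simp add: \<theta>_def field_simps)
    finally have "\<bar>u * a x + v * b x\<bar> powr p \<le>
        (D * (\<theta> * (\<bar>a x\<bar> / A) + (1 - \<theta>) * (\<bar>b x\<bar> / B))) powr p"
      using p by (intro powr_mono2) auto
    also have "\<dots> = D powr p * (\<theta> * (\<bar>a x\<bar> / A) + (1 - \<theta>) * (\<bar>b x\<bar> / B)) powr p"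
      using D AB \<theta> by (intro powr_mult)
    also have "\<dots> \<le> D powr p * (\<theta> * (\<bar>a x\<bar> / A) powr p + (1 - \<theta>) * (\<bar>b x\<bar> / B) powr p)"
      using AB \<theta> p by (intro mult_left_mono powr_convex_ineq) auto
    also have "\<dots> = \<alpha> * \<bar>a x\<bar> powr p + \<beta> * \<bar>b x\<bar> powr p"
      using AB by (simp add: \<alpha>_def \<beta>_def powr_divide algebra_simps)
    finally show ?thesis .
  qed
  have "(\<integral>\<^sup>+x. ennreal (\<bar>u * a x + v * b x\<bar> powr p) \<partial>M) \<le>
      (\<integral>\<^sup>+x. ennreal \<alpha> * ennreal (\<bar>a x\<bar> powr p) + ennreal \<beta> * ennreal (\<bar>b x\<bar> powr p) \<partial>M)"
    using pw nonneg by (intro nn_integral_mono) (auto simp flip: ennreal_mult ennreal_plus)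
  also have "\<dots> = ennreal \<alpha> * (\<integral>\<^sup>+x. ennreal (\<bar>a x\<bar> powr p) \<partial>M) + ennreal \<beta> * (\<integral>\<^sup>+x. ennreal (\<bar>b x\<bar> powr p) \<partial>M)"
    by (simp add: nn_integral_add nn_integral_cmult)
  also have "\<dots> \<le> ennreal \<alpha> * ennreal (A powr p) + ennreal \<beta> * ennreal (B powr p)"
    by (intro add_mono mult_left_mono a b) auto
  also have "\<dots> = ennreal (\<alpha> * A powr p + \<beta> * B powr p)"
    using nonneg by (simp flip: ennreal_mult ennreal_plus)
  also have "\<alpha> * A powr p + \<beta> * B powr p = D powr p"
    using AB by (simp add: \<alpha>_def \<beta>_def flip: distrib_left)
  finally show ?thesis by (simp add: D_def)
qed simp

section \<open>Monotone maps of the unit interval\<close>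

abbreviation unit_lborel :: "real measure" where
  "unit_lborel \<equiv> restrict_space lborel {0<..<1}"

lemma prob_space_unit_lborel: "prob_space unit_lborel"
  by (auto simp: emeasure_restrict_space space_restrict_space intro!: prob_spaceI)

lemma borel_measurable_mono_on_unit:
  fixes P :: "real \<Rightarrow> real"
  assumes "mono_on {0<..<1} P"
  shows "P \<in> borel_measurable unit_lborel"
proof -
  have "sets unit_lborel = sets (restrict_space borel {0<..<1})"
    by (simp add: sets_restrict_space)
  then show ?thesis
    using borel_measurable_mono_on_fnc[OF assms] measurable_cong_sets[of _ _ borel borel] by blast
qed

text \<open>\<open>R\<close> is the quantile function of the given measure. That measure lives on
  (0,1), and \<open>R\<close> must be shown to stay strictly between the endpoints.\<close>

lemma monotone_rearrangement:
  assumes f[measurable]: "f \<in> borel_measurable unit_lborel" and "prob_space (density unit_lborel f)"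
  obtains R where "R \<in> measurable unit_lborel unit_lborel" "mono_on {0<..<1} R"
    "distr unit_lborel unit_lborel R = density unit_lborel f"
proof -
  let ?L = unit_lborel
  have sL: "sets ?L = sets (restrict_space borel {0<..<1})"
    by (simp add: sets_restrict_space)
  have spL: "space ?L = {0<..<1}" by (simp add: space_restrict_space)
  interpret Lf: prob_space "density ?L f" by fact
  have id_m: "(\<lambda>x. x) \<in> borel_measurable (density ?L f)" "(\<lambda>x. x) \<in> borel_measurable ?L"
    by (auto intro!: measurable_restrict_space1)
  \<comment> \<open>The same measure, viewed on the whole line so that its cdf \<open>N.C\<close>
    and the pseudoinverse \<open>N.I\<close> are available.\<close>
  define N where "N = distr (density ?L f) borel (\<lambda>x. x)"
  interpret N: prob_space N unfolding N_def by (rule Lf.prob_space_distr) fact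
  interpret N: cdf_distribution N
    by standard (auto simp: N_def)
  have meas_N: "measure N A = measure (density ?L f) (A \<inter> {0<..<1})" if "A \<in> sets borel" for A
    using id_m that by (simp add: N_def measure_distr spL)
  have I_pos: "0 < N.I w" if "w \<in> {0<..<1}" for w
  proof (rule ccontr)
    assume "\<not> 0 < N.I w"
    then have "w \<le> N.C 0" using N.pseudoinverse[of w 0] that by auto
    moreover have "{..0} \<inter> {0<..<1::real} = {}" by auto
    then have "N.C 0 = 0" unfolding cdf_def by (subst meas_N) auto
    ultimately show False using that by auto
  qed
  have I_less: "N.I w < 1" if "w \<in> {0<..<1}" for w
  proof -
    have "{..<1} \<inter> {0<..<1} = {0<..<1::real}" by auto
    then have "measure N {..<1} = 1"
      using Lf.prob_space by (subst meas_N) (auto simp: spL)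
    \<comment> \<open>The value of the cdf at 1 would only give \<open>N.I w <= 1\<close>. Its left
      limit there is 1 as well, so the cdf exceeds \<open>w\<close> already at some
      \<open>x < 1\<close>.\<close>
    then have "(N.C \<longlongrightarrow> 1) (at_left 1)" using N.cdf_at_left[of 1] by simp
    then have "\<forall>\<^sub>F x in at_left 1. w < N.C x"
      using that by (intro order_tendstoD) auto
    moreover have "\<forall>\<^sub>F x in at_left (1::real). x < 1"
      by (rule eventually_at_leftI[of 0]) auto
    ultimately have "\<forall>\<^sub>F x in at_left (1::real). w < N.C x \<and> x < 1" by eventually_elim auto
    then obtain x where "w < N.C x" "x < 1"
      using eventually_happens'[OF trivial_limit_at_left_real] by blast
    then show ?thesis using N.pseudoinverse[of w x] that by auto
  qed
  have I_b: "N.I \<in> borel_measurable ?L"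
    by (rule borel_measurable_mono_on_unit[OF N.mono_I])
  have I_m: "N.I \<in> measurable ?L ?L"
  proof -
    have "N.I \<in> measurable ?L (restrict_space borel {0<..<1})"
      using I_b I_pos I_less by (intro measurable_restrict_space2) (auto simp: spL)
    then show ?thesis using measurable_cong_sets[OF refl sL] by blast
  qed
  moreover have "distr ?L ?L N.I = density ?L f"
  proof (rule measure_eqI)
    fix A assume "A \<in> sets (distr ?L ?L N.I)"
    then have A: "A \<in> sets ?L" by simp
    then have A': "A \<in> sets borel" "A \<subseteq> {0<..<1}"
      by (auto simp: sets_restrict_space)
    have "emeasure (distr ?L ?L N.I) A = emeasure (distr ?L borel N.I) A"
      using A A' I_m I_b by (simp add: emeasure_distr)
    also have "\<dots> = emeasure N A"
      by (simp add: N.distr_I_eq_M)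
    also have "\<dots> = emeasure (density ?L f) A"
      using A' id_m by (simp add: N_def emeasure_distr spL Int_absorb2)
    finally show "emeasure (distr ?L ?L N.I) A = emeasure (density ?L f) A" .
  qed simp
  ultimately show ?thesis using N.mono_I that by blast
qed

section \<open>Transport inequalities\<close>

lemma wasserstein_le_iff:
  assumes "0 < p" "0 \<le> A"
  shows "wasserstein p \<mu> \<nu> \<le> ennreal A \<longleftrightarrow>
    (INF \<pi>\<in>couplings \<mu> \<nu>. \<integral>\<^sup>+z. ennreal (\<bar>fst z - snd z\<bar> powr p) \<partial>\<pi>) \<le> ennreal (A powr p)"
proof -
  have "ennreal_powr x (1 / p) \<le> ennreal A \<longleftrightarrow> x \<le> ennreal (A powr p)" for x
  proof (cases x)
    case (real r)
    have "r powr (1 / p) \<le> A \<longleftrightarrow> r \<le> A powr p"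
    proof
      assume "r powr (1 / p) \<le> A"
      then have "(r powr (1 / p)) powr p \<le> A powr p" using assms by (intro powr_mono2) auto
      then show "r \<le> A powr p" using assms real by (simp add: powr_powr)
    next
      assume "r \<le> A powr p"
      then have "r powr (1 / p) \<le> (A powr p) powr (1 / p)" using assms real by (intro powr_mono2) auto
      then show "r powr (1 / p) \<le> A" using assms by (simp add: powr_powr)
    qed
    then show ?thesis using real assms by (simp add: ennreal_powr_def)
  qed (simp add: ennreal_powr_def top_unique)
  then show ?thesis by (simp add: wasserstein_def)
qed

lemma enn2ereal_power2_le_iff:
  assumes "0 \<le> A"
  shows "enn2ereal (x\<^sup>2) \<le> ereal (A\<^sup>2) \<longleftrightarrow> x \<le> ennreal A"
proof (cases x)
  case (real r)
  then show ?thesis using assms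
    by (simp add: ennreal_power power2_le_iff_abs_le)
qed (simp add: top_unique power2_eq_square)

definition transport_inequality :: "real \<Rightarrow> real measure \<Rightarrow> real \<Rightarrow> bool" where
  "transport_inequality p \<mu> C \<longleftrightarrow> (\<forall>\<nu>. real_distribution \<nu> \<longrightarrow>
     enn2ereal ((wasserstein p \<mu> \<nu>)\<^sup>2) \<le> ereal C * relative_entropy \<nu> \<mu>)"

text \<open>Two nondecreasing functions of the same variable are comonotone, so every coupling costs
  at least as much as the pair \<open>(F, G)\<close>.\<close>

lemma wasserstein_ge_monotone:
  assumes p: "1 \<le> p" and "0 \<le> A" and F: "mono_on {0<..<1} F" and G: "mono_on {0<..<1} G"
    and W: "wasserstein p (distr unit_lborel borel F) (distr unit_lborel borel G) \<le> ennreal A"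
  shows "(\<integral>\<^sup>+x. ennreal (\<bar>F x - G x\<bar> powr p) \<partial>unit_lborel) \<le> ennreal (A powr p)"
proof -
  let ?c = "couplings (distr unit_lborel borel F) (distr unit_lborel borel G)"
  have "(\<integral>\<^sup>+x. ennreal (\<bar>F x - G x\<bar> powr p) \<partial>unit_lborel) \<le>
      (\<integral>\<^sup>+z. ennreal (\<bar>fst z - snd z\<bar> powr p) \<partial>\<pi>)" if "\<pi> \<in> ?c" for \<pi>
  proof (rule comonotone_cost_le[OF p prob_space_unit_lborel])
    have "sets \<pi> = sets (borel \<Otimes>\<^sub>M borel)" using that by (simp add: couplings_def)
    note [measurable_cong] = this
    show "fst \<in> borel_measurable \<pi>" "snd \<in> borel_measurable \<pi>" by measurable
    fix x y assume "x \<in> space unit_lborel" "y \<in> space unit_lborel" "F x < F y"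
    then show "G x \<le> G y"
      using mono_onD[OF F, of y x] mono_onD[OF G, of x y]
      by (cases "x \<le> y") (auto simp: space_restrict_space)
  qed (use that F G in \<open>auto simp: couplings_def space_restrict_space
        intro: borel_measurable_mono_on_unit\<close>)
  then have "(\<integral>\<^sup>+x. ennreal (\<bar>F x - G x\<bar> powr p) \<partial>unit_lborel) \<le>
      (INF \<pi>\<in>?c. \<integral>\<^sup>+z. ennreal (\<bar>fst z - snd z\<bar> powr p) \<partial>\<pi>)"
    by (rule INF_greatest)
  also have "\<dots> \<le> ennreal (A powr p)"
    using W p \<open>0 \<le> A\<close> by (simp add: wasserstein_le_iff)
  finally show ?thesis .
qed

text \<open>The law of \<open>(F, G)\<close> is one candidate in the infimum.\<close>

lemma wasserstein_distr_le:
  assumes p: "1 \<le> p" and "0 \<le> A" and M: "prob_space M"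
    and [measurable]: "F \<in> borel_measurable M" "G \<in> borel_measurable M"
    and le: "(\<integral>\<^sup>+x. ennreal (\<bar>F x - G x\<bar> powr p) \<partial>M) \<le> ennreal (A powr p)"
  shows "wasserstein p (distr M borel F) (distr M borel G) \<le> ennreal A"
proof -
  let ?\<pi> = "distr M (borel \<Otimes>\<^sub>M borel) (\<lambda>x. (F x, G x))"
  have "?\<pi> \<in> couplings (distr M borel F) (distr M borel G)"
    using prob_space.prob_space_distr[OF M, of "\<lambda>x. (F x, G x)" "borel \<Otimes>\<^sub>M borel"]
    by (simp add: couplings_def distr_distr comp_def)
  then have "(INF \<pi>\<in>couplings (distr M borel F) (distr M borel G).
      \<integral>\<^sup>+z. ennreal (\<bar>fst z - snd z\<bar> powr p) \<partial>\<pi>) \<le> (\<integral>\<^sup>+z. ennreal (\<bar>fst z - snd z\<bar> powr p) \<partial>?\<pi>)"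
    by (rule INF_lower)
  also have "\<dots> = (\<integral>\<^sup>+x. ennreal (\<bar>F x - G x\<bar> powr p) \<partial>M)"
    by (subst nn_integral_distr) auto
  finally show ?thesis
    using le p \<open>0 \<le> A\<close> by (simp add: wasserstein_le_iff)
qed

text \<open>Stated for nondecreasing maps rather than quantile functions, so that it also applies
  between two intermediate interpolants.\<close>

lemma transport_inequality_combination:
  assumes p: "1 \<le> p" and P0: "mono_on {0<..<1} P0" and P1: "mono_on {0<..<1} P1"
    and u: "0 \<le> u" and v: "0 \<le> v" and C: "0 < C0" "0 < C1"
    and pos: "0 < u * sqrt C0 + v * sqrt C1"
    and T0: "transport_inequality p (distr unit_lborel borel P0) C0"
    and T1: "transport_inequality p (distr unit_lborel borel P1) C1"
  shows "transport_inequality p (distr unit_lborel borel (\<lambda>x. u * P0 x + v * P1 x))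
    ((u * sqrt C0 + v * sqrt C1)\<^sup>2)"
  unfolding transport_inequality_def
proof (intro allI impI)
  fix \<nu> assume \<nu>: "real_distribution \<nu>"
  let ?L = unit_lborel
  interpret \<nu>: real_distribution \<nu> by fact
  interpret L: prob_space ?L by (rule prob_space_unit_lborel)
  define Q where "Q x = u * P0 x + v * P1 x" for x
  define s where "s = u * sqrt C0 + v * sqrt C1"
  have [measurable]: "P0 \<in> borel_measurable ?L" "P1 \<in> borel_measurable ?L"
    using P0 P1 by (auto intro: borel_measurable_mono_on_unit)
  have Q[measurable]: "Q \<in> borel_measurable ?L" unfolding Q_def by measurable
  define \<mu> where "\<mu> = distr ?L borel Q"
  interpret \<mu>: prob_space \<mu> unfolding \<mu>_def by (rule L.prob_space_distr) simp
  define H where "H = relative_entropy \<nu> \<mu>"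
  have "enn2ereal ((wasserstein p \<mu> \<nu>)\<^sup>2) \<le> ereal (s\<^sup>2) * H"
  proof (cases "H = \<infinity>")
    \<comment> \<open>Positivity of the constant matters here: in \<open>ereal\<close>, zero times
      infinity is 0.\<close>
    case True
    then show ?thesis using pos by (simp add: s_def)
  next
    case False
    then have ac: "absolutely_continuous \<mu> \<nu>"
      by (auto simp: H_def relative_entropy_def split: if_splits)
    define h where "h = RN_deriv \<mu> \<nu>"
    have h[measurable]: "h \<in> borel_measurable borel"
      using borel_measurable_RN_deriv[of \<mu> \<nu>] by (simp add: h_def \<mu>_def)
    have dh: "density \<mu> h = \<nu>"
      unfolding h_def by (rule \<mu>.density_RN_deriv[OF ac]) (simp add: \<mu>_def)
    define f where "f x = h (Q x)" for x
    have f[measurable]: "f \<in> borel_measurable ?L" unfolding f_def by measurable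
    have \<nu>_eq: "distr (density ?L f) borel Q = \<nu>"
      using density_distr[of h borel Q ?L] by (simp add: f_def[abs_def] dh \<mu>_def[symmetric])
    have Lf: "prob_space (density ?L f)"
      by (rule prob_space_distrD[of Q _ borel]) (auto simp: \<nu>_eq \<nu>.prob_space_axioms)
    have H_eq: "relative_entropy (density ?L f) ?L = H"
      using relative_entropy_density_distr[OF L.prob_space_axioms Q h]
      by (simp add: H_def f_def[symmetric] \<mu>_def[symmetric] dh)
    obtain R where R[measurable]: "R \<in> measurable ?L ?L" and R_mono: "mono_on {0<..<1} R"
      and dR: "distr ?L ?L R = density ?L f"
      using monotone_rearrangement[OF f Lf] by metis
    have R_in: "R x \<in> {0<..<1}" if "x \<in> {0<..<1}" for x
      using measurable_space[OF R, of x] that by (simp add: space_restrict_space)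
    have distr_R: "distr (density ?L f) borel P = distr ?L borel (\<lambda>x. P (R x))"
      if "P \<in> borel_measurable ?L" for P
      using that by (simp add: dR[symmetric] distr_distr comp_def)
    \<comment> \<open>The inequality for the image under \<open>P\<close> is tested on the image of
      the pulled-back measure. Data processing bounds the entropy by \<open>H\<close>, and
      \<open>distr_R\<close> writes both measures as images of Lebesgue measure.\<close>
    have W: "enn2ereal ((wasserstein p (distr ?L borel P) (distr ?L borel (\<lambda>x. P (R x))))\<^sup>2) \<le> ereal C * H"
      if P: "mono_on {0<..<1} P" and C: "0 < C"
        and T: "transport_inequality p (distr ?L borel P) C" for P C
    proof -
      have P_m[measurable]: "P \<in> borel_measurable ?L" using P by (rule borel_measurable_mono_on_unit)
      let ?N = "distr (density ?L f) borel P"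
      have "real_distribution ?N"
        using prob_space.prob_space_distr[OF Lf, of P borel]
        by (simp add: real_distribution_def real_distribution_axioms_def)
      then have "enn2ereal ((wasserstein p (distr ?L borel P) ?N)\<^sup>2) \<le>
          ereal C * relative_entropy ?N (distr ?L borel P)"
        using T by (simp add: transport_inequality_def)
      also have "\<dots> \<le> ereal C * H"
        using relative_entropy_distr_le[OF L.prob_space_axioms f Lf P_m] C
        by (intro ereal_mult_left_mono) (auto simp: H_eq)
      finally show ?thesis by (simp add: distr_R)
    qed
    \<comment> \<open>Nonnegativity of the entropy is read off from the assumed inequality, whose
      left-hand side is nonnegative.\<close>
    have "0 \<le> ereal C0 * H" using W[OF P0 C(1) T0] enn2ereal_nonneg order_trans by blast
    then have "0 \<le> H" using C by (simp add: ereal_zero_le_0_iff)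
    then obtain \<eta> where \<eta>: "H = ereal \<eta>" "0 \<le> \<eta>" using False by (cases H) auto
    \<comment> \<open>The slack \<open>e\<close> keeps the bound positive when the entropy is 0, as
      \<open>nn_integral_powr_add_le\<close> requires.\<close>
    have bound: "(\<integral>\<^sup>+x. ennreal (\<bar>P x - P (R x)\<bar> powr p) \<partial>?L) \<le> ennreal (sqrt (C * (\<eta> + e)) powr p)"
      if P: "mono_on {0<..<1} P" and C: "0 < C"
        and T: "transport_inequality p (distr ?L borel P) C" and e: "0 < e" for P C e
    proof (rule wasserstein_ge_monotone[OF p])
      show "mono_on {0<..<1} (\<lambda>x. P (R x))"
        using P R_mono R_in by (auto simp: mono_on_def)
      have "ereal C * H \<le> ereal ((sqrt (C * (\<eta> + e)))\<^sup>2)"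
        using C \<eta> e by simp
      then have "enn2ereal ((wasserstein p (distr ?L borel P) (distr ?L borel (\<lambda>x. P (R x))))\<^sup>2)
          \<le> ereal ((sqrt (C * (\<eta> + e)))\<^sup>2)"
        using W[OF P C T] by (rule order_trans[rotated])
      then show "wasserstein p (distr ?L borel P) (distr ?L borel (\<lambda>x. P (R x))) \<le> ennreal (sqrt (C * (\<eta> + e)))"
        using C \<eta> e by (subst (asm) enn2ereal_power2_le_iff) auto
    qed (use C \<eta> e P in auto)
    \<comment> \<open>The displacement \<open>Q - Q o R\<close> is the same combination of the
      displacements of \<open>P0\<close> and \<open>P1\<close>, so Minkowski's inequality applies
      and \<open>sqrt (\<eta> + e)\<close> factors out.\<close>
    have main: "wasserstein p \<mu> \<nu> \<le> ennreal (s * sqrt (\<eta> + e))" if e: "0 < e" for e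
    proof -
      have "(\<integral>\<^sup>+x. ennreal (\<bar>u * (P0 x - P0 (R x)) + v * (P1 x - P1 (R x))\<bar> powr p) \<partial>?L)
          \<le> ennreal ((u * sqrt (C0 * (\<eta> + e)) + v * sqrt (C1 * (\<eta> + e))) powr p)"
        using C \<eta> e by (intro nn_integral_powr_add_le[OF p _ _ u v] bound P0 P1 T0 T1) auto
      moreover have "u * (P0 x - P0 (R x)) + v * (P1 x - P1 (R x)) = Q x - Q (R x)" for x
        by (simp add: Q_def algebra_simps)
      moreover have "u * sqrt (C0 * (\<eta> + e)) + v * sqrt (C1 * (\<eta> + e)) = s * sqrt (\<eta> + e)"
        by (simp add: s_def real_sqrt_mult distrib_right)
      ultimately have "(\<integral>\<^sup>+x. ennreal (\<bar>Q x - Q (R x)\<bar> powr p) \<partial>?L) \<le> ennreal ((s * sqrt (\<eta> + e)) powr p)"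
        by simp
      then have "wasserstein p (distr ?L borel Q) (distr ?L borel (\<lambda>x. Q (R x))) \<le> ennreal (s * sqrt (\<eta> + e))"
        using pos \<eta> e by (intro wasserstein_distr_le[OF p]) (auto simp: s_def L.prob_space_axioms)
      then show ?thesis by (simp add: \<mu>_def distr_R[OF Q, symmetric] \<nu>_eq)
    qed
    have "wasserstein p \<mu> \<nu> < \<top>" using main[of 1] by (auto simp: le_less_trans)
    then obtain w where w: "wasserstein p \<mu> \<nu> = ennreal w" "0 \<le> w"
      by (cases "wasserstein p \<mu> \<nu>") auto
    have "w\<^sup>2 / s\<^sup>2 \<le> \<eta>"
    \<comment> \<open>The slack is removed here; division by the square of \<open>s\<close> turns
      the error into exactly \<open>e\<close>.\<close>
    proof (rule field_le_epsilon)
      fix e :: real assume e: "0 < e"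
      have "w \<le> s * sqrt (\<eta> + e)" using main[OF e] w pos \<eta> e by (simp add: s_def)
      then have "w\<^sup>2 \<le> (s * sqrt (\<eta> + e))\<^sup>2" using w by (intro power_mono)
      then show "w\<^sup>2 / s\<^sup>2 \<le> \<eta> + e"
        using pos \<eta> e by (simp add: s_def[symmetric] power_mult_distrib divide_simps mult.commute)
    qed
    then have "w\<^sup>2 \<le> s\<^sup>2 * \<eta>"
      using pos by (simp add: s_def[symmetric] divide_simps mult.commute)
    then show ?thesis using w by (simp add: \<eta> ennreal_power)
  qed
  then show "enn2ereal ((wasserstein p (distr ?L borel (\<lambda>x. u * P0 x + v * P1 x)) \<nu>)\<^sup>2) \<le>
      ereal ((u * sqrt C0 + v * sqrt C1)\<^sup>2) * relative_entropy \<nu> (distr ?L borel (\<lambda>x. u * P0 x + v * P1 x))"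
    by (simp add: H_def \<mu>_def s_def Q_def[abs_def])
qed

section \<open>From transport inequalities to best constants\<close>

lemma ennreal_sqrt_le_iff:
  assumes "0 \<le> A"
  shows "ennreal_sqrt x \<le> ennreal A \<longleftrightarrow> x \<le> ennreal (A\<^sup>2)"
proof (cases x)
  case (real r)
  then show ?thesis using assms by (simp add: ennreal_sqrt_def real_sqrt_le_iff' sqrt_le_D real_le_lsqrt)
qed (simp add: ennreal_sqrt_def top_unique)

text \<open>Since \<open>(t + e)^2\<close> lies strictly above the infimum, some admissible constant
  lies below it.\<close>

lemma transport_constant_approx:
  assumes t: "ennreal_sqrt (transport_constant p \<mu>) = ennreal t" "0 \<le> t" and e: "0 < e"
  obtains C where "0 < C" "transport_inequality p \<mu> C" "sqrt C \<le> t + e"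
proof -
  have "transport_constant p \<mu> \<le> ennreal (t\<^sup>2)"
    using t ennreal_sqrt_le_iff[of t "transport_constant p \<mu>"] by simp
  also have "\<dots> < ennreal ((t + e)\<^sup>2)"
    using t e by (intro ennreal_lessI) (auto intro: power_strict_mono)
  finally obtain C where "0 < C" "transport_inequality p \<mu> C" "ennreal C < ennreal ((t + e)\<^sup>2)"
    unfolding transport_constant_def transport_inequality_def[symmetric] Inf_less_iff by blast
  moreover from this have "sqrt C \<le> t + e"
    using t e by (intro real_le_lsqrt) (auto simp: ennreal_less_iff)
  ultimately show ?thesis using that by blast
qed

lemma sqrt_transport_constant_combination:
  assumes p: "1 \<le> p" and P0: "mono_on {0<..<1} P0" and P1: "mono_on {0<..<1} P1"
    and uv: "0 \<le> u" "0 \<le> v" "u + v = 1"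
  shows "ennreal_sqrt (transport_constant p (distr unit_lborel borel (\<lambda>x. u * P0 x + v * P1 x))) \<le>
    ennreal u * ennreal_sqrt (transport_constant p (distr unit_lborel borel P0)) +
    ennreal v * ennreal_sqrt (transport_constant p (distr unit_lborel borel P1))"
    (is "ennreal_sqrt ?T \<le> ennreal u * ?S0 + ennreal v * ?S1")
proof -
  \<comment> \<open>A zero weight is treated apart because it absorbs an infinite constant; the
    combination is then one of the two maps. With positive weights, an infinite constant makes the
    right-hand side infinite.\<close>
  consider "u = 0" | "v = 0" | "0 < u" "0 < v" "?S0 = \<top> \<or> ?S1 = \<top>"
    | t0 t1 where "0 < u" "0 < v" "?S0 = ennreal t0" "0 \<le> t0" "?S1 = ennreal t1" "0 \<le> t1"
    using uv by (cases ?S0; cases ?S1) force+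
  then show ?thesis
  proof cases
    case 4
    have "ennreal_sqrt ?T \<le> ennreal (u * t0 + v * t1)"
    proof (rule ennreal_le_epsilon)
      fix e :: real assume e: "0 < e"
      obtain C0 where C0: "0 < C0" "transport_inequality p (distr unit_lborel borel P0) C0" "sqrt C0 \<le> t0 + e"
        using transport_constant_approx[OF 4(3,4) e] .
      obtain C1 where C1: "0 < C1" "transport_inequality p (distr unit_lborel borel P1) C1" "sqrt C1 \<le> t1 + e"
        using transport_constant_approx[OF 4(5,6) e] .
      let ?s = "u * sqrt C0 + v * sqrt C1"
      have s: "0 < ?s" using 4 C0 C1 by (simp add: add_pos_pos)
      have "transport_inequality p (distr unit_lborel borel (\<lambda>x. u * P0 x + v * P1 x)) (?s\<^sup>2)"
        using transport_inequality_combination[OF p P0 P1 uv(1,2) C0(1) C1(1) s C0(2) C1(2)] .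
      then have "?T \<le> ennreal (?s\<^sup>2)"
        unfolding transport_constant_def transport_inequality_def[symmetric]
        using s by (intro Inf_lower) (auto intro!: exI[of _ "?s\<^sup>2"])
      then have "ennreal_sqrt ?T \<le> ennreal ?s" using s by (simp add: ennreal_sqrt_le_iff)
      also have "?s \<le> u * (t0 + e) + v * (t1 + e)"
        using uv C0 C1 by (intro add_mono mult_left_mono) auto
      also have "\<dots> = u * t0 + v * t1 + (u + v) * e" by (simp add: algebra_simps)
      finally show "ennreal_sqrt ?T \<le> ennreal (u * t0 + v * t1) + ennreal e"
        using 4 e uv(3) by (simp add: ennreal_leI flip: ennreal_plus)
    qed
    then show ?thesis using 4 by (simp add: ennreal_mult)
  qed (use uv in \<open>auto simp: ennreal_mult_top\<close>)
qed

section \<open>Quantile functions as pseudoinverses of the cdf\<close>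

context
  fixes \<mu> :: "real measure"
  assumes \<mu>: "real_distribution \<mu>"
begin

interpretation cdf_distribution \<mu>
  unfolding cdf_distribution_def by (rule \<mu>)

lemma quantile_eq_I: "quantile \<mu> = (\<lambda>u. Inf {x. u \<le> cdf \<mu> x})"
  by (simp add: quantile_def cdf_def fun_eq_iff)

lemma mono_on_quantile: "mono_on {0<..<1} (quantile \<mu>)"
  using mono_I by (simp add: quantile_eq_I)

lemma distr_quantile: "distr unit_lborel borel (quantile \<mu>) = \<mu>"
  using distr_I_eq_M by (simp add: quantile_eq_I)

end

theorem corollary3p3:
  fixes p :: real and \<mu>0 \<mu>1 :: "real measure"
  assumes "1 \<le> p" and "p \<le> 2"
    and "real_distribution \<mu>0" and "real_distribution \<mu>1"
  shows "ennreal_convex_on {0..1}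
           (\<lambda>t. ennreal_sqrt (transport_constant p (monotone_interpolation \<mu>0 \<mu>1 t))) \<and>
         (\<forall>t\<in>{0<..<1}.
           ennreal_sqrt (transport_constant p (monotone_interpolation \<mu>0 \<mu>1 t))
             \<le> ennreal (1 - t) * ennreal_sqrt (transport_constant p \<mu>0)
               + ennreal t * ennreal_sqrt (transport_constant p \<mu>1))"
proof
  define Q where "Q t x = (1 - t) * quantile \<mu>0 x + t * quantile \<mu>1 x" for t x
  have interp: "monotone_interpolation \<mu>0 \<mu>1 t = distr unit_lborel borel (Q t)" for t
    by (simp add: monotone_interpolation_def Q_def[abs_def])
  note quantile_mono = mono_on_quantile[OF assms(3)] mono_on_quantile[OF assms(4)]
  have mono: "mono_on {0<..<1} (Q t)" if "t \<in> {0..1}" for t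
    using that quantile_mono unfolding Q_def mono_on_def
    by (auto intro!: add_mono mult_left_mono)
  show "ennreal_convex_on {0..1}
      (\<lambda>t. ennreal_sqrt (transport_constant p (monotone_interpolation \<mu>0 \<mu>1 t)))"
    unfolding ennreal_convex_on_def interp
  proof (intro conjI ballI allI impI)
    fix x y u v :: real
    assume xy: "x \<in> {0..1}" "y \<in> {0..1}" and uv: "0 \<le> u" "0 \<le> v" "u + v = 1"
    \<comment> \<open>\<open>Q\<close> is affine in time, so the interpolant at the mean time is the
      image under the combination of the maps \<open>Q x\<close> and \<open>Q y\<close>, both
      nondecreasing.\<close>
    have "Q (u * x + v * y) z = u * Q x z + v * Q y z" for z
    proof -
      have v: "v = 1 - u" using uv(3) by simp
      show ?thesis unfolding Q_def v by (simp add: algebra_simps)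
    qed
    then have "Q (u * x + v * y) = (\<lambda>z. u * Q x z + v * Q y z)" by auto
    then show "ennreal_sqrt (transport_constant p (distr unit_lborel borel (Q (u * x + v * y)))) \<le>
        ennreal u * ennreal_sqrt (transport_constant p (distr unit_lborel borel (Q x))) +
        ennreal v * ennreal_sqrt (transport_constant p (distr unit_lborel borel (Q y)))"
      using sqrt_transport_constant_combination[OF assms(1) mono[OF xy(1)] mono[OF xy(2)] uv] by simp
  qed simp
  show "\<forall>t\<in>{0<..<1}. ennreal_sqrt (transport_constant p (monotone_interpolation \<mu>0 \<mu>1 t))
      \<le> ennreal (1 - t) * ennreal_sqrt (transport_constant p \<mu>0)
        + ennreal t * ennreal_sqrt (transport_constant p \<mu>1)"
  proof
    fix t :: real assume "t \<in> {0<..<1}"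
    then show "ennreal_sqrt (transport_constant p (monotone_interpolation \<mu>0 \<mu>1 t))
        \<le> ennreal (1 - t) * ennreal_sqrt (transport_constant p \<mu>0)
          + ennreal t * ennreal_sqrt (transport_constant p \<mu>1)"
      \<comment> \<open>At the endpoints, \<open>distr_quantile\<close> identifies the images under
        the quantile functions with the given measures.\<close>
      using sqrt_transport_constant_combination[OF assms(1) quantile_mono, of "1 - t" t]
      by (simp add: interp Q_def[abs_def] distr_quantile assms(3,4))
  qed
qed

end
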